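(* Let the following hold for every $i\in\mathcal N=\{1,\dots,N\}$: (i) $f_i$ is convex in $x_i$ for any given $x_{-i}\in X_{-i}$; (ii) $g_i(x_i,x_{-i},\xi_i)=\xi_i^\top Q_i\xi_i+P_i(x)\xi_i$ (the last term being the scalar product of $P_i(x)$ and $\xi_i$); (iii) $P_i(x)=A_ix+b_i$ with $A_i=(A_i^{(1)},\dots,A_i^{(N)})\in\mathbb R^{m\times nN}$, $A_i^{(j)}\in\mathbb R^{m\times n}$ the block multiplying $x_j$, and $b_i\in\mathbb R^m$; (iv) there is an orthogonal matrix $L_i$ such that $Q_i=L_i^\top D_iL_i$, where $D_i$ is a diagonal positive semidefinite matrix with sorted eigenvalues (decreasing along the diagonal). Assume also that the set of robust Nash equilibria of the game $\bar G$ (defined in the context) is non-empty. Let $\zeta_i>0$ be arbitrarily small and $$Z=\{z\in\mathbb R^{(n+1)N}:\ x_i\in X_i,\ \lambda_i\ge\lambda_{\max}(Q_i)+\zeta_i\ \ \forall i\in\mathcal N\},$$ where $z=\mathrm{col}((z_i)_{i\in\mathcal N})$, $z_i=(x_i,\lambda_i)$. Then a solution $z^\ast$ of the variational inequality problem with mapping $F(z)=\mathrm{col}\big((F_i(z))_{i\in\mathcal N}\big)$, where $$F_i(z)=\begin{pmatrix}\nabla_{x_i}f_i(x_i,x_{-i})+\dfrac1{2K_i}\displaystyle\sum_{k_i=1}^{K_i}(A_i^{(i)})^\top\tilde Q_i(\lambda_i)\tilde W^{(k_i)}(x_i,x_{-i},\lambda_i)\\[3mm] \varepsilon_i^2-\dfrac1{K_i}\displaystyle\sum_{k_i=1}^{K_i}\|\xi_i^{(k_i)}\|^2+\dfrac1{4K_i}\displaystyle\sum_{k_i=1}^{K_i}\Big(4(\xi_i^{(k_i)})^\top\tilde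 Q_i(\lambda_i)\tilde W^{(k_i)}(x,\lambda_i)-\big\|\tilde W^{(k_i)}(x,\lambda_i)\big\|^2_{\frac{d\tilde Q_i}{d\lambda_i}}\Big)\end{pmatrix},$$ over $Z\cap V(z^\ast)$, with $V(z^\ast)$ a convex local neighbourhood around $z^\ast$ (that is, $F(z^\ast)^\top(z-z^\ast)\ge0$ for all $z\in Z\cap V(z^\ast)$), is a Nash equilibrium of the game $G_R$ over $Z$.
   Context: There are $N$ agents with decisions $x_i\in X_i\subseteq\mathbb R^n$; $x=\mathrm{col}((x_i)_{i=1}^N)=(x_i,x_{-i})$, $X_{-i}=\prod_{j\ne i}X_j$, $f_i:\mathbb R^n\times\mathbb R^{n(N-1)}\to\mathbb R$, $g_i:\mathbb R^n\times\mathbb R^{n(N-1)}\times\mathbb R^m\to\mathbb R$. For each $i$, a Wasserstein radius $\varepsilon_i$ and $K_i$ samples $\xi_i^{(1)},\dots,\xi_i^{(K_i)}\in\mathbb R^m$ are fixed. $\|\cdot\|$ is the Euclidean norm, $\|w\|_M^2$ denotes $w^\top Mw$, and $\mathrm{col}$ denotes stacking. Notation: $\tilde Q_i(\lambda_i)=\mathrm{diag}\big(\tfrac1{\lambda_i-\lambda_{\max}(D_i)},\dots,\tfrac1{\lambda_i-\lambda_{\min}(D_i)}\big)=(\lambda_iI_m-D_i)^{-1}$; $\tilde P_i(x)=L_iP_i(x)$; $\tilde\xi_i^{(k_i)}=L_i\xi_i^{(k_i)}$; $\tilde W^{(k_i)}(x,\lambda_i)=\tilde W^{(k_i)}(x_i,x_{-i},\lambda_i)=\tilde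 P_i(x)+2\lambda_i\tilde\xi_i^{(k_i)}$; $\frac{d\tilde Q_i}{d\lambda_i}$ is obtained by differentiating the diagonal elements of $\tilde Q_i$. Game $\bar G$: each agent $i$ minimizes over $x_i\in X_i$, $\lambda_i\ge0$ the cost $$J_i(x_i,\lambda_i,x_{-i})=f_i(x_i,x_{-i})+\lambda_i\varepsilon_i^2+\frac1{K_i}\sum_{k_i=1}^{K_i}\sup_{\xi_i\in\mathbb R^m}\big[\xi_i^\top Q_i\xi_i+P_i(x)\xi_i-\lambda_i\|\xi_i-\xi_i^{(k_i)}\|^2\big].$$ A robust Nash equilibrium of $\bar G$ is a point $(x^\ast,\lambda^\ast)$ such that, for all $i$, $(x_i^\ast,\lambda_i^\ast)$ minimizes $J_i(\cdot,\cdot,x_{-i}^\ast)$ over $x_i\in X_i$, $\lambda_i\ge0$. Game $G_R$: each agent $i$ minimizes over $x_i\in X_i$, $\lambda_i>\lambda_{\max}(Q_i)$ the cost $$\mathcal J_i(x_i,\lambda_i,x_{-i})=f_i(x_i,x_{-i})+\lambda_i\Big(\varepsilon_i^2-\frac1{K_i}\sum_{k_i=1}^{K_i}(\xi_i^{(k_i)})^\top\xi_i^{(k_i)}\Big)+\frac1{4K_i}\sum_{k_i=1}^{K_i}\tilde W^{(k_i)}(x_i,x_{-i},\lambda_i)^\top\tilde Q_i(\lambda_i)\tilde W^{(k_i)}(x_i,x_{-i},\lambda_i).$$ A point $z^\ast=(x_i^\ast,\lambda_i^\ast)_{i\in\mathcal N}\in Z$ is a Nash equilibrium of $G_R$ over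 $Z$ if, for every $i\in\mathcal N$, $\mathcal J_i(x_i^\ast,\lambda_i^\ast,x_{-i}^\ast)\le\mathcal J_i(x_i,\lambda_i,x_{-i}^\ast)$ for all $x_i\in X_i$ and all $\lambda_i\ge\lambda_{\max}(Q_i)+\zeta_i$.
   Formalization: F_i is corrected to the true gradient of the cost: L_i A_i^(i) replaces A_i^(i), L_i ξ_i^(k) replaces ξ_i^(k), and the term weighted by dQ̃_i/dλ_i is added, not subtracted (the displayed F_i makes the claim false); X_i is taken convex and f_i differentiable in x_i. *)

theory Defs
  imports "HOL-Analysis.Analysis"
begin

text \<open>
  Agents are the elements of a finite type \<open>'i\<close>. A joint decision \<open>x = col (x\<^sub>i)\<close> has type
  \<open>real^'n^'i\<close>, and \<open>z = col ((x\<^sub>i, \<lambda>\<^sub>i))\<close> has type \<open>((real^'n) \<times> real)^'i\<close>, whose library inner product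
  is the Euclidean one on the stacked vector. The pair \<open>(y, x\<^sub>-\<^sub>i)\<close> is \<open>replace x i y\<close>, so a function
  of \<open>(x\<^sub>i, x\<^sub>-\<^sub>i)\<close> is a function of the joint vector.
\<close>

definition replace :: "'s^'i \<Rightarrow> 'i \<Rightarrow> 's \<Rightarrow> 's^'i" where
  "replace z i y = (\<chi> j. if j = i then y else z $ j)"

definition decisions :: "('x \<times> real)^'i \<Rightarrow> 'x^'i" where
  "decisions z = (\<chi> i. fst (z $ i))"

definition is_nash :: "('i \<Rightarrow> 's set) \<Rightarrow> ('i \<Rightarrow> 's^'i \<Rightarrow> 'c::linorder) \<Rightarrow> 's^'i \<Rightarrow> bool" where
  "is_nash S J z \<longleftrightarrow> (\<forall>i. z $ i \<in> S i \<and> (\<forall>y \<in> S i. J i z \<le> J i (replace z i y)))"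

definition vi_solution :: "('v::real_inner \<Rightarrow> 'v) \<Rightarrow> 'v set \<Rightarrow> 'v \<Rightarrow> bool" where
  "vi_solution F C z \<longleftrightarrow> z \<in> C \<and> (\<forall>w \<in> C. 0 \<le> F z \<bullet> (w - z))"

definition lambda_max :: "real^'m^'m \<Rightarrow> real" where
  "lambda_max M = Max {\<mu>. \<exists>v. v \<noteq> 0 \<and> M *v v = \<mu> *\<^sub>R v}"

definition diagonal_matrix :: "real^'m^'m \<Rightarrow> bool" where
  "diagonal_matrix M \<longleftrightarrow> (\<forall>p q. p \<noteq> q \<longrightarrow> M $ p $ q = 0)"

definition pos_semidef :: "real^'m^'m \<Rightarrow> bool" where
  "pos_semidef M \<longleftrightarrow> transpose M = M \<and> (\<forall>v. 0 \<le> v \<bullet> (M *v v))"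

text \<open>Only meaningful where \<open>h\<close> is differentiable at \<open>y\<close>; the gradient is then unique.\<close>

definition gradient :: "('v::real_inner \<Rightarrow> real) \<Rightarrow> 'v \<Rightarrow> 'v" where
  "gradient h y = (THE d. GDERIV h y :> d)"

text \<open>
  The cost of agent \<open>i\<close> in the game \<open>\<bar>G\<close>, for a general uncertain cost \<open>g\<^sub>i\<close>. It is extended
  real valued because the supremum over the whole space can be \<open>\<infinity>\<close> (for small \<open>\<lambda>\<^sub>i\<close>).
\<close>

definition robust_cost ::
  "(real^'n^'i \<Rightarrow> real) \<Rightarrow> (real^'n^'i \<Rightarrow> real^'m \<Rightarrow> real) \<Rightarrow> real \<Rightarrow> nat \<Rightarrow> (nat \<Rightarrow> real^'m)
    \<Rightarrow> 'i \<Rightarrow> ((real^'n) \<times> real)^'i \<Rightarrow> ereal" where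
  "robust_cost fi gi \<epsilon> K \<xi> i z =
    (let x = decisions z; lam = snd (z $ i) in
      ereal (fi x + lam * \<epsilon>^2) +
      ereal (1 / real K) * (\<Sum>k=1..K. SUP w. ereal (gi x w - lam * (norm (w - \<xi> k))^2)))"

definition Q_tilde :: "real^'m^'m \<Rightarrow> real \<Rightarrow> real^'m^'m" where
  "Q_tilde D lam = (\<chi> p q. if p = q then 1 / (lam - D $ p $ p) else 0)"

definition dQ_tilde :: "real^'m^'m \<Rightarrow> real \<Rightarrow> real^'m^'m" where
  "dQ_tilde D lam = (\<chi> p q. deriv (\<lambda>l. Q_tilde D l $ p $ q) lam)"

definition W_tilde ::
  "real^'m^'m \<Rightarrow> (real^'n^'i \<Rightarrow> real^'m) \<Rightarrow> real^'m \<Rightarrow> real^'n^'i \<Rightarrow> real \<Rightarrow> real^'m" where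
  "W_tilde L P \<xi>k x lam = L *v P x + (2 * lam) *\<^sub>R (L *v \<xi>k)"

definition reformulated_cost ::
  "(real^'n^'i \<Rightarrow> real) \<Rightarrow> (real^'n^'i \<Rightarrow> real^'m) \<Rightarrow> real^'m^'m \<Rightarrow> real^'m^'m
    \<Rightarrow> real \<Rightarrow> nat \<Rightarrow> (nat \<Rightarrow> real^'m) \<Rightarrow> 'i \<Rightarrow> ((real^'n) \<times> real)^'i \<Rightarrow> real" where
  "reformulated_cost fi P L D \<epsilon> K \<xi> i z =
    (let x = decisions z; lam = snd (z $ i) in
      fi x + lam * (\<epsilon>^2 - 1 / real K * (\<Sum>k=1..K. \<xi> k \<bullet> \<xi> k)) +
      1 / (4 * real K) *
        (\<Sum>k=1..K. W_tilde L P (\<xi> k) x lam \<bullet> (Q_tilde D lam *v W_tilde L P (\<xi> k) x lam)))"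

text \<open>
  The block \<open>F\<^sub>i(z)\<close> of the VI mapping: the gradient of \<open>reformulated_cost\<close> in \<open>(x\<^sub>i, \<lambda>\<^sub>i)\<close>.
  \<open>Aii\<close> is the block of \<open>A\<^sub>i\<close> multiplying \<open>x\<^sub>i\<close>.

  Some presentations of this formula write \<open>A\<^sub>i\<^sub>i\<close> and \<open>\<xi>\<^sub>k\<close> in place of \<open>L A\<^sub>i\<^sub>i\<close> and \<open>L \<xi>\<^sub>k\<close>, and
  subtract the last quadratic term. The factors \<open>L\<close> are needed since \<open>Q_tilde\<close> and \<open>W_tilde\<close> live
  in the rotated coordinates, and the last term is added because \<open>dQ_tilde\<close> is the derivative
  proper, with diagonal entries \<open>- 1 / (\<lambda> - d\<^sub>p)\<^sup>2\<close>; the minus sign is the right one for a seminorm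
  weighted by the entries \<open>1 / (\<lambda> - d\<^sub>p)\<^sup>2\<close>.
\<close>

definition F_block ::
  "(real^'n^'i \<Rightarrow> real) \<Rightarrow> (real^'n^'i \<Rightarrow> real^'m) \<Rightarrow> real^'n^'m \<Rightarrow> real^'m^'m \<Rightarrow> real^'m^'m
    \<Rightarrow> real \<Rightarrow> nat \<Rightarrow> (nat \<Rightarrow> real^'m) \<Rightarrow> 'i \<Rightarrow> ((real^'n) \<times> real)^'i \<Rightarrow> (real^'n) \<times> real" where
  "F_block fi P Aii L D \<epsilon> K \<xi> i z =
    (let x = decisions z; lam = snd (z $ i); W = (\<lambda>k. W_tilde L P (\<xi> k) x lam) in
      (gradient (\<lambda>y. fi (replace x i y)) (x $ i) +
         (1 / (2 * real K)) *\<^sub>R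
           (\<Sum>k=1..K. transpose (L ** Aii) *v (Q_tilde D lam *v W k)),
       \<epsilon>^2 - 1 / real K * (\<Sum>k=1..K. (norm (\<xi> k))^2) +
         1 / (4 * real K) *
           (\<Sum>k=1..K. 4 * ((L *v \<xi> k) \<bullet> (Q_tilde D lam *v W k)) + W k \<bullet> (dQ_tilde D lam *v W k))))"

end

theory Submission
  imports Defs
begin

text \<open>
  Where \<open>\<lambda>\<^sub>i > \<lambda>\<^sub>m\<^sub>a\<^sub>x(D\<^sub>i)\<close>, every summand of the quadratic part of the cost of agent \<open>i\<close> is a
  function \<open>w\<^sup>2 / s\<close> of arguments \<open>w\<close> and \<open>s > 0\<close> that are affine in \<open>(x\<^sub>i, \<lambda>\<^sub>i)\<close>. Such a function
  lies above its tangents, hence so does the whole cost, whose gradient is \<open>F\<^sub>i\<close>. The variational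
  inequality, tested with a short step of agent \<open>i\<close> towards a given deviation, says that the
  derivative in the direction of that deviation is nonnegative; convexity makes the local
  neighbourhood immaterial.
\<close>

section \<open>Tangent inequalities and gradients\<close>

lemma square_divide_above_tangent:
  fixes w w' s s' :: real
  assumes "0 < s" "0 < s'"
  shows "w\<^sup>2 / s + 2 * (w' - w) * w / s - (s' - s) * w\<^sup>2 / s\<^sup>2 \<le> w'\<^sup>2 / s'"
proof -
  \<comment> \<open>The function \<open>w\<^sup>2 / s\<close> is the perspective of the square.
    Writing its gap to the tangent plane as a weighted square gives convexity without any
    Hessian.\<close>
  have "w'\<^sup>2 / s' - (w\<^sup>2 / s + 2 * (w' - w) * w / s - (s' - s) * w\<^sup>2 / s\<^sup>2) = s' * (w' / s' - w / s)\<^sup>2"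
    using assms by (simp add: field_simps power2_eq_square)
  also have "\<dots> \<ge> 0"
    using assms by simp
  finally show ?thesis
    by linarith
qed

text \<open>Since \<open>gradient\<close> is a definite description, both existence and uniqueness
  are at stake. The Riesz representative of the derivative, built from its values on
  \<open>Basis\<close>, is a gradient, and uniqueness of derivatives makes it the only one.\<close>

lemma has_derivative_eq_inner_gradient:
  fixes h :: "'v::euclidean_space \<Rightarrow> real"
  assumes "(h has_derivative h') (at x)"
  shows "h' v = v \<bullet> gradient h x"
proof -
  interpret h': bounded_linear h'
    using assms by (rule has_derivative_bounded_linear)
  define d where "d = (\<Sum>e\<in>Basis. h' e *\<^sub>R e)"
  have d: "h' u = u \<bullet> d" for u
  proof -
    have "h' u = h' (\<Sum>e\<in>Basis. (u \<bullet> e) *\<^sub>R e)"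
      by (simp add: euclidean_representation)
    also have "\<dots> = (\<Sum>e\<in>Basis. (u \<bullet> e) * h' e)"
      by (simp add: h'.sum h'.scaleR)
    also have "\<dots> = u \<bullet> d"
      by (simp add: d_def inner_sum_right mult.commute)
    finally show ?thesis .
  qed
  have gd: "GDERIV h x :> d"
    using assms unfolding gderiv_def by (simp add: d [abs_def])
  have "gradient h x = d"
    unfolding gradient_def
  proof (rule the_equality)
    show "GDERIV h x :> d"
      by (rule gd)
  next
    fix e assume "GDERIV h x :> e"
    then have "(\<lambda>u. u \<bullet> e) = (\<lambda>u. u \<bullet> d)"
      using gd unfolding gderiv_def by (rule has_derivative_unique)
    then show "e = d"
      by (simp add: fun_eq_iff vector_eq_ldot)
  qed
  then show ?thesis
    using d by simp
qed

text \<open>Along the segment from x to y, convexity bounds every difference quotient by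
  \<open>h y - h x\<close>. The quotients tend to the directional derivative, so it obeys the same
  bound.\<close>

lemma convex_on_above_gradient:
  fixes h :: "'v::euclidean_space \<Rightarrow> real"
  assumes cvx: "convex_on S h" and S: "x \<in> S" "y \<in> S" and diff: "h differentiable (at x)"
  shows "h x + gradient h x \<bullet> (y - x) \<le> h y"
proof -
  define \<phi> where "\<phi> t = h (x + t *\<^sub>R (y - x))" for t
  obtain h' where h': "(h has_derivative h') (at x)"
    using diff by (auto simp: differentiable_def)
  interpret h': bounded_linear h'
    using h' by (rule has_derivative_bounded_linear)
  have "((\<lambda>t. x + t *\<^sub>R (y - x)) has_derivative (\<lambda>t. t *\<^sub>R (y - x))) (at 0)"
    by (auto intro!: derivative_eq_intros)
  then have "(\<phi> has_derivative (\<lambda>t. h' (t *\<^sub>R (y - x)))) (at 0)"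
    unfolding \<phi>_def by (rule has_derivative_compose [where g = h]) (simp add: h')
  then have "(\<phi> has_field_derivative h' (y - x)) (at 0)"
    by (rule has_derivative_imp_has_field_derivative) (simp add: h'.scaleR mult.commute)
  \<comment> \<open>The limit is taken from the right because convexity is available only on S, and
    x may lie on its boundary: only t between 0 and 1 is sure to stay in S.\<close>
  then have "((\<lambda>t. (\<phi> t - \<phi> 0) / t) \<longlongrightarrow> h' (y - x)) (at_right 0)"
    unfolding has_field_derivative_iff by (auto intro: tendsto_within_subset)
  moreover have "\<forall>\<^sub>F t in at_right 0. (\<phi> t - \<phi> 0) / t \<le> h y - h x"
  proof -
    have "(\<phi> t - \<phi> 0) / t \<le> h y - h x" if "0 < t" "t < 1" for t
    proof -
      have "\<phi> t = h ((1 - t) *\<^sub>R x + t *\<^sub>R y)"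
        unfolding \<phi>_def by (simp add: algebra_simps)
      also have "\<dots> \<le> (1 - t) * h x + t * h y"
        using that S by (intro convex_onD [OF cvx]) auto
      finally show ?thesis
        using that by (simp add: \<phi>_def field_simps)
    qed
    then show ?thesis
      using eventually_at_right_real [of 0 1] by (auto elim: eventually_mono)
  qed
  ultimately have "h' (y - x) \<le> h y - h x"
    by (rule tendsto_upperbound) simp
  then show ?thesis
    using has_derivative_eq_inner_gradient [OF h'] by (simp add: inner_commute)
qed

section \<open>Diagonal matrices and the largest eigenvalue\<close>

lemma diagonal_mult_vector_nth:
  assumes "diagonal_matrix D"
  shows "(D *v v) $ p = D $ p $ p * v $ p"
proof -
  have "(D *v v) $ p = (\<Sum>q\<in>UNIV. if q = p then D $ p $ p * v $ p else 0)"
    unfolding matrix_vector_mult_def vec_lambda_beta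
    using assms by (intro sum.cong) (auto simp: diagonal_matrix_def)
  then show ?thesis
    by simp
qed

text \<open>\<open>Max\<close> bounds its elements only on a finite set, so two facts are combined.
  Rotating an eigenvector by L shows that every eigenvalue is a diagonal entry of D, hence there are
  finitely many; rotating a unit vector back shows that each diagonal entry is an
  eigenvalue.\<close>

lemma diagonal_entry_le_lambda_max:
  fixes L D :: "real^'m^'m"
  assumes L: "orthogonal_matrix L" and D: "diagonal_matrix D"
  shows "D $ p $ p \<le> lambda_max (transpose L ** D ** L)"
proof -
  define E where "E = {\<mu>. \<exists>v. v \<noteq> 0 \<and> (transpose L ** D ** L) *v v = \<mu> *\<^sub>R v}"
  have LL: "transpose L ** L = mat 1" "L ** transpose L = mat 1"
    using L by (auto simp: orthogonal_matrix_def)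
  have "E \<subseteq> range (\<lambda>q. D $ q $ q)"
  proof
    fix \<mu> assume "\<mu> \<in> E"
    then obtain v where v: "v \<noteq> 0" "(transpose L ** D ** L) *v v = \<mu> *\<^sub>R v"
      by (auto simp: E_def)
    have "D *v (L *v v) = L *v ((transpose L ** D ** L) *v v)"
      by (simp add: matrix_vector_mul_assoc matrix_mul_assoc LL)
    also have "\<dots> = \<mu> *\<^sub>R (L *v v)"
      by (simp add: v matrix_vector_mult_scaleR)
    finally have eig: "D *v (L *v v) = \<mu> *\<^sub>R (L *v v)" .
    have "transpose L *v (L *v v) = v"
      by (simp add: matrix_vector_mul_assoc LL del: transpose_matrix_vector)
    then have "L *v v \<noteq> 0"
      using v(1) by auto
    then obtain q where q: "(L *v v) $ q \<noteq> 0"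
      by (auto simp: vec_eq_iff)
    have "D $ q $ q * (L *v v) $ q = \<mu> * (L *v v) $ q"
      using arg_cong [OF eig, of "\<lambda>u. u $ q"] by (simp add: diagonal_mult_vector_nth [OF D])
    then show "\<mu> \<in> range (\<lambda>q. D $ q $ q)"
      using q by auto
  qed
  then have "finite E"
    by (rule finite_subset) simp
  moreover have "D $ p $ p \<in> E"
  proof -
    define v where "v = transpose L *v axis p 1"
    have Lv: "L *v v = axis p 1"
      by (simp add: v_def matrix_vector_mul_assoc LL del: transpose_matrix_vector)
    then have "v \<noteq> 0"
      by auto
    moreover have "(transpose L ** D ** L) *v v = (D $ p $ p) *\<^sub>R v"
    proof -
      have "D *v axis p 1 = (D $ p $ p) *\<^sub>R axis p 1"
        by (simp add: vec_eq_iff diagonal_mult_vector_nth [OF D] axis_def)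
      then show ?thesis
        by (simp add: Lv v_def [symmetric] matrix_vector_mult_scaleR
            del: transpose_matrix_vector flip: matrix_vector_mul_assoc)
    qed
    ultimately show ?thesis
      unfolding E_def by blast
  qed
  ultimately show ?thesis
    unfolding lambda_max_def E_def [symmetric] by (rule Max_ge)
qed

section \<open>The quadratic form of \<open>Q_tilde\<close> and its tangents\<close>

lemma Q_tilde_mult_vector_nth: "(Q_tilde D l *v w) $ p = w $ p / (l - D $ p $ p)"
  by (subst diagonal_mult_vector_nth) (auto simp: diagonal_matrix_def Q_tilde_def)

text \<open>The hypothesis keeps l away from the pole of this diagonal entry, so
  \<open>deriv\<close> is a genuine derivative there. Off the diagonal the zero function is
  differentiated.\<close>

lemma dQ_tilde_mult_vector_nth:
  assumes "D $ p $ p < l"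
  shows "(dQ_tilde D l *v w) $ p = - w $ p / (l - D $ p $ p)\<^sup>2"
proof -
  have "((\<lambda>l. 1 / (l - D $ p $ p)) has_field_derivative - 1 / (l - D $ p $ p)\<^sup>2) (at l)"
    using assms by (auto intro!: derivative_eq_intros simp: power2_eq_square)
  then have "dQ_tilde D l $ p $ p = - 1 / (l - D $ p $ p)\<^sup>2"
    by (simp add: dQ_tilde_def Q_tilde_def DERIV_imp_deriv)
  moreover have "diagonal_matrix (dQ_tilde D l)"
    by (simp add: diagonal_matrix_def dQ_tilde_def Q_tilde_def)
  ultimately show ?thesis
    by (simp add: diagonal_mult_vector_nth)
qed

text \<open>In coordinates the form is a sum of terms \<open>w\<^sup>2 / s\<close> with
  \<open>s = l - D $ p $ p\<close>, and the scalar tangent inequality applies to each. The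
  \<open>dQ_tilde\<close> term is added because its entries carry the minus sign themselves.\<close>

lemma Q_tilde_form_above_tangent:
  assumes "\<And>p. D $ p $ p < l" "\<And>p. D $ p $ p < l'"
  shows "w \<bullet> (Q_tilde D l *v w) + 2 * ((w' - w) \<bullet> (Q_tilde D l *v w))
      + (l' - l) * (w \<bullet> (dQ_tilde D l *v w)) \<le> w' \<bullet> (Q_tilde D l' *v w')"
proof -
  have "w \<bullet> (Q_tilde D l *v w) + 2 * ((w' - w) \<bullet> (Q_tilde D l *v w))
      + (l' - l) * (w \<bullet> (dQ_tilde D l *v w))
    = (\<Sum>p\<in>UNIV. (w $ p)\<^sup>2 / (l - D $ p $ p) + 2 * (w' $ p - w $ p) * w $ p / (l - D $ p $ p)
        - ((l' - D $ p $ p) - (l - D $ p $ p)) * (w $ p)\<^sup>2 / (l - D $ p $ p)\<^sup>2)"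
    by (simp add: inner_vec_def Q_tilde_mult_vector_nth dQ_tilde_mult_vector_nth assms
        sum_distrib_left sum.distrib sum_subtractf sum_negf power2_eq_square mult.assoc)
      (simp add: algebra_simps)
  also have "\<dots> \<le> (\<Sum>p\<in>UNIV. (w' $ p)\<^sup>2 / (l' - D $ p $ p))"
    using assms by (intro sum_mono square_divide_above_tangent) simp_all
  also have "\<dots> = w' \<bullet> (Q_tilde D l' *v w')"
    by (simp add: inner_vec_def Q_tilde_mult_vector_nth power2_eq_square)
  finally show ?thesis .
qed

section \<open>The cost of one agent as a function of that agent's block\<close>

lemma replace_nth: "replace x i y $ j = (if j = i then y else x $ j)"
  by (simp add: replace_def)

lemma replace_same [simp]: "replace x i (x $ i) = x"
  by (simp add: replace_def vec_eq_iff)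

lemma decisions_nth: "decisions z $ j = fst (z $ j)"
  by (simp add: decisions_def)

lemma decisions_replace: "decisions (replace z i y) = replace (decisions z) i (fst y)"
  by (simp add: decisions_def replace_def vec_eq_iff)

lemma affine_replace:
  fixes A :: "'i::finite \<Rightarrow> real^'n^'m"
  assumes P: "\<And>x. P x = (\<Sum>j\<in>UNIV. A j *v (x $ j)) + b"
  shows "P (replace x i u) = P x + A i *v (u - x $ i)"
proof -
  have "P (replace x i u) - P x = (\<Sum>j\<in>UNIV. A j *v (replace x i u $ j - x $ j))"
    by (simp add: P sum_subtractf matrix_vector_mult_diff_distrib)
  also have "\<dots> = (\<Sum>j\<in>UNIV. if j = i then A i *v (u - x $ i) else 0)"
    by (intro sum.cong) (auto simp: replace_nth)
  finally show ?thesis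
    by (simp add: algebra_simps)
qed

text \<open>This inequality is all that the equilibrium argument needs of \<open>F_block\<close>, so
  its being the gradient of the cost is never proved separately. It adds the tangent inequality of
  \<open>fi\<close> to those of the quadratic forms.\<close>

lemma reformulated_cost_above_tangent:
  fixes A :: "'i::finite \<Rightarrow> real^'n^'m"
  assumes P: "\<And>x. P x = (\<Sum>j\<in>UNIV. A j *v (x $ j)) + b"
    and cvx: "convex_on X (\<lambda>u. fi (replace (decisions z) i u))"
    and diff: "(\<lambda>u. fi (replace (decisions z) i u)) differentiable (at (fst (z $ i)))"
    and X: "fst (z $ i) \<in> X" "fst y \<in> X"
    and dom: "\<And>p. D $ p $ p < snd (z $ i)" "\<And>p. D $ p $ p < snd y"
  shows "reformulated_cost fi P L D \<epsilon> K \<xi> i z + F_block fi P (A i) L D \<epsilon> K \<xi> i z \<bullet> (y - z $ i)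
      \<le> reformulated_cost fi P L D \<epsilon> K \<xi> i (replace z i y)"
proof -
  define x where "x = decisions z"
  define l where "l = snd (z $ i)"
  define u where "u = fst y - x $ i"
  define l' where "l' = snd y"
  define W where "W k = W_tilde L P (\<xi> k) x l" for k
  define W' where "W' k = W_tilde L P (\<xi> k) (replace x i (fst y)) l'" for k
  define q where "q k = Q_tilde D l *v W k" for k
  define G where "G = gradient (\<lambda>u. fi (replace x i u)) (x $ i)"
  define B where "B = transpose (L ** A i)"
  define c where "c = \<epsilon>\<^sup>2 - 1 / real K * (\<Sum>k=1..K. \<xi> k \<bullet> \<xi> k)"
  have xi: "x $ i = fst (z $ i)"
    by (simp add: x_def decisions_nth)
  have f: "fi x + G \<bullet> u \<le> fi (replace x i (fst y))"
    using convex_on_above_gradient [OF cvx X diff]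
    by (simp add: G_def u_def xi flip: x_def) (simp flip: xi)
  \<comment> \<open>\<open>W_tilde\<close> is affine in the agent's own decision and multiplier, so
    its increment is exact.\<close>
  have W_diff: "W' k - W k = (L ** A i) *v u + (2 * (l' - l)) *\<^sub>R (L *v \<xi> k)" for k
    unfolding W'_def W_def W_tilde_def affine_replace [OF P] u_def [symmetric]
    by (simp add: matrix_vector_mul_assoc algebra_simps)
  have quad: "W k \<bullet> q k + (2 * (u \<bullet> (B *v q k))
      + (l' - l) * (4 * ((L *v \<xi> k) \<bullet> q k) + W k \<bullet> (dQ_tilde D l *v W k)))
    \<le> W' k \<bullet> (Q_tilde D l' *v W' k)" for k
  proof -
    \<comment> \<open>The tangent inequality doubles this product, which produces the factors 2 and
      4 below. After division by 4K they are the factors 1/(2K) and 4/(4K) of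
      \<open>F_block\<close>.\<close>
    have "(W' k - W k) \<bullet> q k = u \<bullet> (B *v q k) + 2 * (l' - l) * ((L *v \<xi> k) \<bullet> q k)"
      using dot_lmul_matrix [of "q k" "L ** A i" u]
      by (simp add: W_diff inner_add_right B_def inner_commute [of _ u] inner_commute [of _ "q k"])
    then show ?thesis
      using Q_tilde_form_above_tangent [of D l l' "W k" "W' k"] dom
      by (simp add: q_def l_def l'_def algebra_simps)
  qed
  have "reformulated_cost fi P L D \<epsilon> K \<xi> i z + F_block fi P (A i) L D \<epsilon> K \<xi> i z \<bullet> (y - z $ i)
    = (fi x + l * c + 1 / (4 * real K) * (\<Sum>k=1..K. W k \<bullet> q k))
      + ((G + (1 / (2 * real K)) *\<^sub>R (\<Sum>k=1..K. B *v q k)) \<bullet> u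
      + (c + 1 / (4 * real K) *
          (\<Sum>k=1..K. 4 * ((L *v \<xi> k) \<bullet> q k) + W k \<bullet> (dQ_tilde D l *v W k))) * (l' - l))"
    unfolding reformulated_cost_def F_block_def Let_def inner_prod_def
    by (simp add: x_def [symmetric] l_def [symmetric] W_def [symmetric] q_def [symmetric]
        G_def [symmetric] B_def [symmetric] c_def u_def l'_def xi [symmetric] power2_norm_eq_inner)
  \<comment> \<open>The part linear in the multiplier is its own tangent:
    \<open>l * c + c * (l' - l)\<close> is \<open>l' * c\<close>. The rest is collected sample by
    sample to match \<open>quad\<close>.\<close>
  also have "\<dots> = (fi x + G \<bullet> u) + l' * c + 1 / (4 * real K) *
      (\<Sum>k=1..K. W k \<bullet> q k + (2 * (u \<bullet> (B *v q k))
        + (l' - l) * (4 * ((L *v \<xi> k) \<bullet> q k) + W k \<bullet> (dQ_tilde D l *v W k))))"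
  proof -
    have "(\<Sum>k=1..K. B *v q k) \<bullet> u = (\<Sum>k=1..K. u \<bullet> (B *v q k))"
      by (simp add: inner_commute [of _ u] inner_sum_right)
    then show ?thesis
      unfolding sum.distrib sum_distrib_left [symmetric]
      by (simp add: algebra_simps diff_divide_distrib)
  qed
  also have "\<dots> \<le> fi (replace x i (fst y)) + l' * c
      + 1 / (4 * real K) * (\<Sum>k=1..K. W' k \<bullet> (Q_tilde D l' *v W' k))"
    by (intro add_mono f order_refl mult_left_mono sum_mono quad) simp_all
  also have "\<dots> = reformulated_cost fi P L D \<epsilon> K \<xi> i (replace z i y)"
    unfolding reformulated_cost_def Let_def
    by (simp add: decisions_replace replace_nth c_def W'_def flip: x_def l'_def)
  finally show ?thesis .
qed

section \<open>From the local variational inequality to the equilibrium\<close>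

lemma vi_solution_block_nonneg:
  fixes F :: "('v::real_inner)^'i \<Rightarrow> 'v^'i::finite"
  assumes vi: "vi_solution F ({w. \<forall>j. w $ j \<in> S j} \<inter> V) z"
    and S: "convex (S i)" and V: "z \<in> interior V" and y: "y \<in> S i"
  shows "0 \<le> F z $ i \<bullet> (y - z $ i)"
proof -
  have zS: "z $ j \<in> S j" for j
    using vi by (auto simp: vi_solution_def)
  \<comment> \<open>Only block i moves, so the inner product on the stacked vector reduces to that
    block. The product form of the constraints leaves the other agents feasible, and convexity of
    \<open>S i\<close> keeps agent i feasible.\<close>
  define p where "p t = z + t *\<^sub>R axis i (y - z $ i)" for t
  have "(p \<longlongrightarrow> z) (at_right 0)"
    unfolding p_def by (auto intro!: tendsto_eq_intros)
  then have "\<forall>\<^sub>F t in at_right 0. p t \<in> interior V"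
    using V by (intro topological_tendstoD) auto
  moreover have "\<forall>\<^sub>F t in at_right (0::real). t \<in> {0<..<1}"
    by (rule eventually_at_right_real) simp
  ultimately have "\<forall>\<^sub>F t in at_right 0. p t \<in> interior V \<and> 0 < t \<and> t < 1"
    by eventually_elim simp
  then obtain t where t: "p t \<in> interior V" "0 < t" "t < 1"
    using eventually_happens' [OF trivial_limit_at_right_real] by blast
  have "p t $ j \<in> S j" for j
  proof (cases "j = i")
    case True
    have "p t $ i = (1 - t) *\<^sub>R (z $ i) + t *\<^sub>R y"
      by (simp add: p_def algebra_simps)
    then show ?thesis
      using True convexD [OF S zS y, of "1 - t" t] t by simp
  qed (simp add: p_def axis_def zS)
  then have "0 \<le> F z \<bullet> (p t - z)"
    using vi t(1) interior_subset unfolding vi_solution_def by blast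
  \<comment> \<open>The step length factors out and is positive, so the full deviation, which may
    leave V, inherits the sign.\<close>
  then have "0 \<le> t * (F z $ i \<bullet> (y - z $ i))"
    by (simp add: p_def inner_axis)
  then show ?thesis
    using t(2) by (simp add: zero_le_mult_iff)
qed

theorem lemma3p3:
  fixes X :: "'i::finite \<Rightarrow> (real^'n) set"
    and f :: "'i \<Rightarrow> real^'n^'i \<Rightarrow> real"
    and g :: "'i \<Rightarrow> real^'n^'i \<Rightarrow> real^'m::{finite,wellorder} \<Rightarrow> real"
    and \<epsilon> :: "'i \<Rightarrow> real"
    and K :: "'i \<Rightarrow> nat"
    and \<xi> :: "'i \<Rightarrow> nat \<Rightarrow> real^'m::_"
    and Q L D :: "'i \<Rightarrow> real^('m::_)^('m::_)"
    and P :: "'i \<Rightarrow> real^'n^'i \<Rightarrow> real^'m::_"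
    and A :: "'i \<Rightarrow> 'i \<Rightarrow> real^'n^'m::_"
    and b :: "'i \<Rightarrow> real^'m::_"
    and \<zeta> :: "'i \<Rightarrow> real"
    and Z V :: "(((real^'n) \<times> real)^'i) set"
    and F :: "((real^'n) \<times> real)^'i \<Rightarrow> ((real^'n) \<times> real)^'i"
    and z :: "((real^'n) \<times> real)^'i"
  assumes radius: "\<And>i. 0 \<le> \<epsilon> i"
    and samples: "\<And>i. 1 \<le> K i"
    and f_convex: "\<And>i x. (\<And>j. j \<noteq> i \<Longrightarrow> x $ j \<in> X j) \<Longrightarrow>
          convex_on (X i) (\<lambda>y. f i (replace x i y))"
    and f_diff: "\<And>i x. (\<And>j. x $ j \<in> X j) \<Longrightarrow>
          (\<lambda>y. f i (replace x i y)) differentiable (at (x $ i))"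
    and g_def: "\<And>i x w. g i x w = w \<bullet> (Q i *v w) + P i x \<bullet> w"
    and P_def: "\<And>i x. P i x = (\<Sum>j\<in>UNIV. A i j *v (x $ j)) + b i"
    and L_orthogonal: "\<And>i. orthogonal_matrix (L i)"
    and Q_decomp: "\<And>i. Q i = transpose (L i) ** D i ** L i"
    and D_diagonal: "\<And>i. diagonal_matrix (D i)"
    and D_psd: "\<And>i. pos_semidef (D i)"
    and D_sorted: "\<And>i p q. p \<le> q \<Longrightarrow> D i $ q $ q \<le> D i $ p $ p"
    and robust_nash_nonempty:
          "{z'. is_nash (\<lambda>i. X i \<times> {0..})
                  (\<lambda>i. robust_cost (f i) (g i) (\<epsilon> i) (K i) (\<xi> i) i) z'} \<noteq> {}"
    and zeta_pos: "\<And>i. 0 < \<zeta> i"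
    and Z_def: "Z = {z'. \<forall>i. fst (z' $ i) \<in> X i \<and> lambda_max (Q i) + \<zeta> i \<le> snd (z' $ i)}"
    and F_def: "F = (\<lambda>z'. \<chi> i. F_block (f i) (P i) (A i i) (L i) (D i) (\<epsilon> i) (K i) (\<xi> i) i z')"
    and V_convex: "convex V"
    and V_nbhd: "z \<in> interior V"
    and vi: "vi_solution F (Z \<inter> V) z"
  shows "is_nash (\<lambda>i. X i \<times> {lambda_max (Q i) + \<zeta> i..})
           (\<lambda>i. reformulated_cost (f i) (P i) (L i) (D i) (\<epsilon> i) (K i) (\<xi> i) i) z"
proof -
  define S where "S i = X i \<times> {lambda_max (Q i) + \<zeta> i..}" for i
  have Z: "Z = {w. \<forall>j. w $ j \<in> S j}"
    unfolding Z_def S_def by (simp add: mem_Times_iff)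
  have zS: "z $ i \<in> S i" for i
    using vi by (simp add: vi_solution_def Z)
  have zX: "decisions z $ i \<in> X i" for i
    using zS [of i] by (simp add: S_def mem_Times_iff decisions_nth)
  have cvx: "convex_on (X i) (\<lambda>u. f i (replace (decisions z) i u))" for i
    using zX by (intro f_convex)
  \<comment> \<open>The margin \<open>\<zeta> i\<close> makes the inequality strict, so no pole of
    \<open>Q_tilde\<close> lies in the strategy set.\<close>
  have dom: "D i $ p $ p < snd y" if "y \<in> S i" for i p y
    using that zeta_pos [of i]
      diagonal_entry_le_lambda_max [OF L_orthogonal [of i] D_diagonal [of i], of p]
    by (simp add: S_def mem_Times_iff Q_decomp)
  have "reformulated_cost (f i) (P i) (L i) (D i) (\<epsilon> i) (K i) (\<xi> i) i z
      \<le> reformulated_cost (f i) (P i) (L i) (D i) (\<epsilon> i) (K i) (\<xi> i) i (replace z i y)"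
    if y: "y \<in> S i" for i y
  proof -
    \<comment> \<open>Convexity of \<open>X i\<close> is read off from \<open>convex_on\<close>,
      which includes convexity of the domain.\<close>
    have "convex (S i)"
      unfolding S_def by (intro convex_Times convex_on_imp_convex [OF cvx]) simp
    then have "0 \<le> F z $ i \<bullet> (y - z $ i)"
      using vi V_nbhd y unfolding Z by (intro vi_solution_block_nonneg)
    moreover have "reformulated_cost (f i) (P i) (L i) (D i) (\<epsilon> i) (K i) (\<xi> i) i z
        + F z $ i \<bullet> (y - z $ i)
      \<le> reformulated_cost (f i) (P i) (L i) (D i) (\<epsilon> i) (K i) (\<xi> i) i (replace z i y)"
      unfolding F_def vec_lambda_beta
    proof (rule reformulated_cost_above_tangent [OF P_def cvx])
      show "(\<lambda>u. f i (replace (decisions z) i u)) differentiable at (fst (z $ i))"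
        using f_diff [of "decisions z" i] zX by (simp add: decisions_nth)
    qed (use zS [of i] y dom in \<open>auto simp: S_def mem_Times_iff\<close>)
    ultimately show ?thesis
      by linarith
  qed
  then show ?thesis
    unfolding is_nash_def using zS by (simp add: S_def)
qed

end
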